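(* If $p \colon E \to B$ and $p' \colon E' \to B$ are fibrewise homotopy equivalent fibrations, then $$\mathrm{TC}^{\Sigma}[p \colon E \to B] = \mathrm{TC}^{\Sigma}[p' \colon E' \to B].$$
   Context: Fibration means Hurewicz fibration, $I=[0,1]$. A fibrewise map between $p \colon E \to B$ and $p' \colon E' \to B$ is a map $h \colon E \to E'$ with $p' \circ h = p$; a fibrewise homotopy is a homotopy $H \colon E \times I \to E'$ with $p'(H(e,t)) = p(e)$ for all $e,t$. The fibrations are fibrewise homotopy equivalent if there are fibrewise maps $f \colon E' \to E$ and $g \colon E \to E'$ with $f\circ g$ fibrewise homotopic to $\mathrm{id}_E$ and $g \circ f$ fibrewise homotopic to $\mathrm{id}_{E'}$. Let $G = \mathbb{Z}_2 = \langle g\rangle$. For a fibration $p \colon E \to B$: $E \times_B E = \{(e_1,e_2)\in E\times E \mid p(e_1)=p(e_2)\}$ with $g\cdot(e_1,e_2)=(e_2,e_1)$; $E^I_B = \{\gamma \in E^I \mid p\circ\gamma \text{ is constant}\}$ (subspace of $E^I$ with compact-open topology) with $(g\cdot\gamma)(t)=\gamma(1-t)$; $\Pi \colon E^I_B \to E \times_B E$, $\Pi(\gamma)=(\gamma(0),\gamma(1))$, is a $G$-fibration. The equivariant sectional category $\mathrm{secat}_G(q)$ of a $G$-map $q \colon X \to Y$ is the least nonnegative integer $k$ such that $Y$ has a cover by $G$-invariant open sets $U_0,\dots,U_k$ with $G$-maps $s_i \colon U_i \to X$ such that $q\circ s_i$ is $G$-homotopic to the inclusion $U_i \hookrightarrow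 Y$ ($\infty$ if none exists). The symmetrized parametrized topological complexity is $\mathrm{TC}^{\Sigma}[p \colon E\to B] := \mathrm{secat}_G(\Pi)$. *)

theory Defs
  imports "HOL-Analysis.Analysis" "HOL-Algebra.Elementary_Groups"
begin

section \<open>Mapping spaces\<close>

abbreviation unit_interval :: "real topology" where
  "unit_interval \<equiv> top_of_set {0..1}"

text \<open>Points of a mapping space are functions that are \<^const>\<open>undefined\<close> off
  \<open>topspace X\<close>, so that each continuous map \<open>X \<rightarrow> Y\<close> is represented exactly once.\<close>

definition mapping_space :: "'x topology \<Rightarrow> 'y topology \<Rightarrow> ('x \<Rightarrow> 'y) set" where
  "mapping_space X Y = {f \<in> extensional (topspace X). continuous_map X Y f}"

definition compact_open_topology :: "'x topology \<Rightarrow> 'y topology \<Rightarrow> ('x \<Rightarrow> 'y) topology" where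
  "compact_open_topology X Y =
     topology_generated_by
       {{f \<in> mapping_space X Y. f ` K \<subseteq> U} | K U. compactin X K \<and> openin Y U}"

lemma topspace_compact_open_topology [simp]:
  "topspace (compact_open_topology X Y) = mapping_space X Y"
proof -
  have "{f \<in> mapping_space X Y. f ` {} \<subseteq> {}}
      \<in> {{f \<in> mapping_space X Y. f ` K \<subseteq> U} | K U. compactin X K \<and> openin Y U}"
    by blast
  then show ?thesis
    unfolding compact_open_topology_def topology_generated_by_topspace by auto
qed

lemma openin_compact_open_topology:
  "compactin X K \<Longrightarrow> openin Y U
    \<Longrightarrow> openin (compact_open_topology X Y) {f \<in> mapping_space X Y. f ` K \<subseteq> U}"
  unfolding compact_open_topology_def by (rule topology_generated_by_Basis) blast

lemma continuous_map_into_compact_open_topology: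
  assumes "\<And>z. z \<in> topspace Z \<Longrightarrow> f z \<in> mapping_space X Y"
    and "\<And>K U. compactin X K \<Longrightarrow> openin Y U \<Longrightarrow> openin Z {z \<in> topspace Z. f z ` K \<subseteq> U}"
  shows "continuous_map Z (compact_open_topology X Y) f"
  unfolding compact_open_topology_def
proof (rule continuous_on_generated_topo)
  fix V assume "V \<in> {{f \<in> mapping_space X Y. f ` K \<subseteq> U} | K U. compactin X K \<and> openin Y U}"
  then obtain K U where KU: "compactin X K" "openin Y U"
    and V: "V = {f \<in> mapping_space X Y. f ` K \<subseteq> U}"
    by blast
  have "f -` V \<inter> topspace Z = {z \<in> topspace Z. f z ` K \<subseteq> U}"
    unfolding V using assms(1) by blast
  then show "openin Z (f -` V \<inter> topspace Z)" using assms(2) [OF KU] by simp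
next
  have "mapping_space X Y =
      \<Union> {{f \<in> mapping_space X Y. f ` K \<subseteq> U} | K U. compactin X K \<and> openin Y U}"
    using topspace_compact_open_topology [of X Y]
    unfolding compact_open_topology_def topology_generated_by_topspace by (rule sym)
  then show "f ` topspace Z
      \<subseteq> \<Union> {{f \<in> mapping_space X Y. f ` K \<subseteq> U} | K U. compactin X K \<and> openin Y U}"
    using assms(1) by (metis image_subsetI)
qed

lemma continuous_map_curry:
  assumes h: "continuous_map (prod_topology T X) Y h"
  shows "continuous_map X (compact_open_topology T Y) (\<lambda>x. restrict (\<lambda>t. h (t, x)) (topspace T))"
proof (rule continuous_map_into_compact_open_topology)
  fix x assume x: "x \<in> topspace X"
  have "continuous_map T Y (h \<circ> (\<lambda>t. (t, x)))"
    by (rule continuous_map_compose [OF _ h]) (simp add: continuous_map_pairwise o_def x)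
  then have "continuous_map T Y (restrict (\<lambda>t. h (t, x)) (topspace T))"
    by (rule continuous_map_eq) auto
  then show "restrict (\<lambda>t. h (t, x)) (topspace T) \<in> mapping_space T Y"
    by (simp add: mapping_space_def)
next
  fix K U assume K: "compactin T K" and U: "openin Y U"
  let ?W = "{z \<in> topspace (prod_topology T X). h z \<in> U}"
  have W: "openin (prod_topology T X) ?W"
    by (rule openin_continuous_map_preimage [OF h U])
  have KT: "K \<subseteq> topspace T" by (rule compactin_subset_topspace [OF K])
  let ?S = "{x \<in> topspace X. restrict (\<lambda>t. h (t, x)) (topspace T) ` K \<subseteq> U}"
  have "\<exists>V. openin X V \<and> x \<in> V \<and> V \<subseteq> ?S" if x: "x \<in> ?S" for x
  proof -
    have xX: "x \<in> topspace X" and sub: "K \<times> {x} \<subseteq> ?W"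
      using x KT by auto
    obtain A V where "openin T A" "openin X V" "K \<subseteq> A" "x \<in> V" "A \<times> V \<subseteq> ?W"
      using tube_lemma_left [OF W K xX sub] by blast
    then have "V \<subseteq> ?S" using KT openin_subset by fastforce
    then show ?thesis using \<open>openin X V\<close> \<open>x \<in> V\<close> by blast
  qed
  then show "openin X ?S"
    by (subst openin_subopen) blast
qed

lemma continuous_map_path_eval:
  "continuous_map (prod_topology unit_interval (compact_open_topology unit_interval Y)) Y
     (\<lambda>(t, f). f t)"
  unfolding continuous_map
proof (intro conjI allI impI)
  show "(\<lambda>(t, f). f t) ` topspace (prod_topology unit_interval (compact_open_topology unit_interval Y))
      \<subseteq> topspace Y"
    by (auto simp: mapping_space_def continuous_map_def)
next
  fix U assume U: "openin Y U"
  let ?P = "prod_topology unit_interval (compact_open_topology unit_interval Y)"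
  let ?S = "{z \<in> topspace ?P. (case z of (t, f) \<Rightarrow> f t) \<in> U}"
  have "\<exists>V. openin ?P V \<and> z \<in> V \<and> V \<subseteq> ?S" if z: "z \<in> ?S" for z
  proof -
    obtain t f where tf: "z = (t, f)" by (cases z)
    have t: "t \<in> {0..1}" and f: "f \<in> mapping_space unit_interval Y" and ft: "f t \<in> U"
      using z tf by auto
    have "openin unit_interval {s \<in> topspace unit_interval. f s \<in> U}"
      using f U openin_continuous_map_preimage unfolding mapping_space_def by blast
    then obtain T where T: "open T" "{s \<in> {0..1}. f s \<in> U} = {0..1} \<inter> T"
      by (auto simp: openin_open)
    then have "t \<in> T" using t ft by auto
    then obtain e where e: "e > 0" "cball t e \<subseteq> T"
      using T(1) open_contains_cball by blast
    let ?K = "{0..1} \<inter> cball t e"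
    have K: "compactin unit_interval ?K"
      by (simp add: compactin_subtopology compact_Int)
    have KU: "f ` ?K \<subseteq> U" using T(2) e(2) by blast
    have N: "openin unit_interval ({0..1} \<inter> ball t e)"
      by (simp add: openin_open_Int)
    let ?V = "({0..1} \<inter> ball t e) \<times> {f \<in> mapping_space unit_interval Y. f ` ?K \<subseteq> U}"
    have "openin ?P ?V"
      using N openin_compact_open_topology [OF K U] by (simp add: openin_prod_Times_iff)
    moreover have "z \<in> ?V" using tf t f KU e(1) by auto
    moreover have "?V \<subseteq> ?S" using ball_subset_cball by fastforce
    ultimately show ?thesis by blast
  qed
  then show "openin ?P ?S"
    by (subst openin_subopen) blast
qed


section \<open>Hurewicz fibrations\<close>

definition homotopy_lifting_property ::
  "'x topology \<Rightarrow> 'e topology \<Rightarrow> 'b topology \<Rightarrow> ('e \<Rightarrow> 'b) \<Rightarrow> bool" where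
  "homotopy_lifting_property X E B p \<longleftrightarrow>
     (\<forall>f h. continuous_map X E f \<longrightarrow>
        continuous_map (prod_topology unit_interval X) B h \<longrightarrow>
        (\<forall>x \<in> topspace X. h (0, x) = p (f x)) \<longrightarrow>
        (\<exists>H. continuous_map (prod_topology unit_interval X) E H \<and>
             (\<forall>x \<in> topspace X. H (0, x) = f x) \<and>
             (\<forall>t \<in> {0..1}. \<forall>x \<in> topspace X. p (H (t, x)) = h (t, x))))"

text \<open>The homotopy lifting property is meant for all spaces, whereas a definition can only quantify
  over the topologies on one fixed type. The type below contains the universal test space
  \<open>{(e, \<gamma>). p e = \<gamma> 0}\<close>, so nothing is lost: lemma \<open>hurewicz_fibration_lifting\<close> gives
  the property for spaces on an arbitrary type.\<close>

definition hurewicz_fibration :: "'e topology \<Rightarrow> 'b topology \<Rightarrow> ('e \<Rightarrow> 'b) \<Rightarrow> bool" where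
  "hurewicz_fibration E B p \<longleftrightarrow>
     continuous_map E B p \<and>
     (\<forall>X :: ('e \<times> (real \<Rightarrow> 'b)) topology. homotopy_lifting_property X E B p)"

lemma hurewicz_fibration_lifting:
  fixes X :: "'x topology" and E :: "'e topology" and B :: "'b topology"
  assumes fib: "hurewicz_fibration E B p"
  shows "homotopy_lifting_property X E B p"
  unfolding homotopy_lifting_property_def
proof (intro allI impI)
  fix f h
  assume f: "continuous_map X E f"
    and h: "continuous_map (prod_topology unit_interval X) B h"
    and hf: "\<forall>x \<in> topspace X. h (0, x) = p (f x)"
  let ?PB = "compact_open_topology unit_interval B"
  define W :: "('e \<times> (real \<Rightarrow> 'b)) topology"
    where "W = subtopology (prod_topology E ?PB) {(e, \<gamma>). p e = \<gamma> 0}"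
  define j where "j = (\<lambda>x. (f x, restrict (\<lambda>t. h (t, x)) {0..1}))"
  have Wfst: "continuous_map W E fst" and Wsnd: "continuous_map W ?PB snd"
    unfolding W_def by (rule continuous_map_from_subtopology, rule continuous_map_fst continuous_map_snd)+
  have "continuous_map X (prod_topology E ?PB) j"
    using f continuous_map_curry [OF h] by (simp add: continuous_map_pairwise o_def j_def)
  then have j: "continuous_map X W j"
    unfolding W_def by (rule continuous_map_into_subtopology) (simp add: j_def hf)
  let ?ev = "\<lambda>(t, w). snd w t"
  have "continuous_map (prod_topology unit_interval W) B ((\<lambda>(t, \<gamma>). \<gamma> t) \<circ> (\<lambda>(t, w). (t, snd w)))"
    by (rule continuous_map_compose [OF _ continuous_map_path_eval])
       (use continuous_map_compose [OF continuous_map_snd Wsnd, of unit_interval] in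
         \<open>simp add: continuous_map_pairwise o_def case_prod_unfold continuous_map_fst\<close>)
  then have ev: "continuous_map (prod_topology unit_interval W) B ?ev"
    by (simp add: o_def case_prod_unfold)
  have ev0: "\<forall>w \<in> topspace W. ?ev (0, w) = p (fst w)"
    by (auto simp: W_def)
  have lift: "homotopy_lifting_property W E B p"
    using fib unfolding hurewicz_fibration_def by blast
  obtain H where H: "continuous_map (prod_topology unit_interval W) E H"
    and H0: "\<forall>w \<in> topspace W. H (0, w) = fst w"
    and pH: "\<forall>t \<in> {0..1}. \<forall>w \<in> topspace W. p (H (t, w)) = ?ev (t, w)"
    using lift [unfolded homotopy_lifting_property_def, rule_format, OF Wfst ev ev0 [rule_format]]
    by blast
  have jW: "j x \<in> topspace W" if "x \<in> topspace X" for x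
    using j that by (auto simp: continuous_map_def)
  show "\<exists>H. continuous_map (prod_topology unit_interval X) E H \<and>
             (\<forall>x \<in> topspace X. H (0, x) = f x) \<and>
             (\<forall>t \<in> {0..1}. \<forall>x \<in> topspace X. p (H (t, x)) = h (t, x))"
  proof (intro exI conjI ballI)
    have "continuous_map (prod_topology unit_interval X) (prod_topology unit_interval W)
            (\<lambda>z. (fst z, j (snd z)))"
      using continuous_map_compose [OF continuous_map_snd j, of unit_interval]
      by (simp add: continuous_map_pairwise o_def continuous_map_fst)
    then show "continuous_map (prod_topology unit_interval X) E (H \<circ> (\<lambda>z. (fst z, j (snd z))))"
      by (rule continuous_map_compose [OF _ H])
  next
    fix x assume "x \<in> topspace X"
    then show "(H \<circ> (\<lambda>z. (fst z, j (snd z)))) (0, x) = f x"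
      using H0 jW by (simp add: j_def)
  next
    fix t x assume "t \<in> {0..1::real}" "x \<in> topspace X"
    then show "p ((H \<circ> (\<lambda>z. (fst z, j (snd z)))) (t, x)) = h (t, x)"
      using pH jW by (simp add: j_def)
  qed
qed


section \<open>Fibrewise homotopy equivalence\<close>

definition fibrewise_map ::
  "'e topology \<Rightarrow> ('e \<Rightarrow> 'b) \<Rightarrow> 'f topology \<Rightarrow> ('f \<Rightarrow> 'b) \<Rightarrow> ('e \<Rightarrow> 'f) \<Rightarrow> bool" where
  "fibrewise_map E p E' p' h \<longleftrightarrow>
     continuous_map E E' h \<and> (\<forall>e \<in> topspace E. p' (h e) = p e)"

definition fibrewise_homotopic ::
  "'e topology \<Rightarrow> ('e \<Rightarrow> 'b) \<Rightarrow> 'f topology \<Rightarrow> ('f \<Rightarrow> 'b) \<Rightarrow> ('e \<Rightarrow> 'f) \<Rightarrow> ('e \<Rightarrow> 'f) \<Rightarrow> bool" where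
  "fibrewise_homotopic E p E' p' =
     homotopic_with (\<lambda>h. \<forall>e \<in> topspace E. p' (h e) = p e) E E'"

definition fibrewise_homotopy_equivalent ::
  "'e topology \<Rightarrow> ('e \<Rightarrow> 'b) \<Rightarrow> 'f topology \<Rightarrow> ('f \<Rightarrow> 'b) \<Rightarrow> bool" where
  "fibrewise_homotopy_equivalent E p E' p' \<longleftrightarrow>
     (\<exists>f g. fibrewise_map E' p' E p f \<and> fibrewise_map E p E' p' g \<and>
        fibrewise_homotopic E p E p (f \<circ> g) id \<and>
        fibrewise_homotopic E' p' E' p' (g \<circ> f) id)"


section \<open>Equivariant sectional category\<close>

text \<open>Groups are discrete; an action is a function \<open>act\<close> with \<open>act g x\<close> standing for \<open>g \<cdot> x\<close>.\<close>

definition G_space :: "'g monoid \<Rightarrow> 'x topology \<Rightarrow> ('g \<Rightarrow> 'x \<Rightarrow> 'x) \<Rightarrow> bool" where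
  "G_space G X act \<longleftrightarrow>
     group G \<and>
     (\<forall>g \<in> carrier G. continuous_map X X (act g)) \<and>
     (\<forall>x \<in> topspace X. act \<one>\<^bsub>G\<^esub> x = x) \<and>
     (\<forall>g \<in> carrier G. \<forall>h \<in> carrier G. \<forall>x \<in> topspace X. act (g \<otimes>\<^bsub>G\<^esub> h) x = act g (act h x))"

definition equivariant_on ::
  "'g monoid \<Rightarrow> 'x set \<Rightarrow> ('g \<Rightarrow> 'x \<Rightarrow> 'x) \<Rightarrow> ('g \<Rightarrow> 'y \<Rightarrow> 'y) \<Rightarrow> ('x \<Rightarrow> 'y) \<Rightarrow> bool" where
  "equivariant_on G S act act' f \<longleftrightarrow>
     (\<forall>g \<in> carrier G. \<forall>x \<in> S. f (act g x) = act' g (f x))"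

definition G_map ::
  "'g monoid \<Rightarrow> 'x topology \<Rightarrow> ('g \<Rightarrow> 'x \<Rightarrow> 'x) \<Rightarrow> 'y topology \<Rightarrow> ('g \<Rightarrow> 'y \<Rightarrow> 'y) \<Rightarrow> ('x \<Rightarrow> 'y) \<Rightarrow> bool"
  where
  "G_map G X act Y act' f \<longleftrightarrow>
     continuous_map X Y f \<and> equivariant_on G (topspace X) act act' f"

text \<open>A \<open>G\<close>-homotopy is a homotopy that is equivariant for the trivial action on the interval,
  that is, through equivariant maps.\<close>

definition G_homotopic ::
  "'g monoid \<Rightarrow> 'x topology \<Rightarrow> ('g \<Rightarrow> 'x \<Rightarrow> 'x) \<Rightarrow> 'y topology \<Rightarrow> ('g \<Rightarrow> 'y \<Rightarrow> 'y) \<Rightarrow>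
     ('x \<Rightarrow> 'y) \<Rightarrow> ('x \<Rightarrow> 'y) \<Rightarrow> bool" where
  "G_homotopic G X act Y act' = homotopic_with (equivariant_on G (topspace X) act act') X Y"

definition G_invariant :: "'g monoid \<Rightarrow> ('g \<Rightarrow> 'x \<Rightarrow> 'x) \<Rightarrow> 'x set \<Rightarrow> bool" where
  "G_invariant G act S \<longleftrightarrow> (\<forall>g \<in> carrier G. act g ` S \<subseteq> S)"

definition equivariant_sectional_cover ::
  "'g monoid \<Rightarrow> 'x topology \<Rightarrow> ('g \<Rightarrow> 'x \<Rightarrow> 'x) \<Rightarrow> 'y topology \<Rightarrow> ('g \<Rightarrow> 'y \<Rightarrow> 'y) \<Rightarrow>
     ('x \<Rightarrow> 'y) \<Rightarrow> nat \<Rightarrow> bool" where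
  "equivariant_sectional_cover G X actX Y actY q k \<longleftrightarrow>
     (\<exists>U :: nat \<Rightarrow> 'y set.
        (\<Union>i\<le>k. U i) = topspace Y \<and>
        (\<forall>i\<le>k. openin Y (U i) \<and> G_invariant G actY (U i) \<and>
           (\<exists>s. G_map G (subtopology Y (U i)) actY X actX s \<and>
                G_homotopic G (subtopology Y (U i)) actY Y actY (q \<circ> s) id)))"

text \<open>\<^term>\<open>Inf {} = (\<infinity> :: enat)\<close> covers the case that no cover exists.\<close>

definition equivariant_secat ::
  "'g monoid \<Rightarrow> 'x topology \<Rightarrow> ('g \<Rightarrow> 'x \<Rightarrow> 'x) \<Rightarrow> 'y topology \<Rightarrow> ('g \<Rightarrow> 'y \<Rightarrow> 'y) \<Rightarrow>
     ('x \<Rightarrow> 'y) \<Rightarrow> enat" where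
  "equivariant_secat G X actX Y actY q =
     Inf (enat ` {k. equivariant_sectional_cover G X actX Y actY q k})"


section \<open>Symmetrized parametrized topological complexity\<close>

abbreviation Z2 :: "int monoid" where
  "Z2 \<equiv> integer_mod_group 2"

definition fibre_product :: "'e topology \<Rightarrow> ('e \<Rightarrow> 'b) \<Rightarrow> ('e \<times> 'e) topology" where
  "fibre_product E p = subtopology (prod_topology E E) {(e1, e2). p e1 = p e2}"

definition swap_action :: "int \<Rightarrow> 'e \<times> 'e \<Rightarrow> 'e \<times> 'e" where
  "swap_action k = (if k = 0 then id else prod.swap)"

definition fibrewise_path_space :: "'e topology \<Rightarrow> ('e \<Rightarrow> 'b) \<Rightarrow> (real \<Rightarrow> 'e) topology" where
  "fibrewise_path_space E p =
     subtopology (compact_open_topology unit_interval E) {\<gamma>. \<exists>b. \<forall>t \<in> {0..1}. p (\<gamma> t) = b}"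

definition reversal_action :: "int \<Rightarrow> (real \<Rightarrow> 'e) \<Rightarrow> (real \<Rightarrow> 'e)" where
  "reversal_action k = (if k = 0 then id else (\<lambda>\<gamma>. restrict (\<lambda>t. \<gamma> (1 - t)) {0..1}))"

definition endpoint_map :: "(real \<Rightarrow> 'e) \<Rightarrow> 'e \<times> 'e" where
  "endpoint_map \<gamma> = (\<gamma> 0, \<gamma> 1)"

definition TC_Sigma :: "'e topology \<Rightarrow> ('e \<Rightarrow> 'b) \<Rightarrow> enat" where
  "TC_Sigma E p =
     equivariant_secat Z2 (fibrewise_path_space E p) reversal_action
       (fibre_product E p) swap_action endpoint_map"

lemma G_space_fibre_product: "G_space Z2 (fibre_product E p) swap_action"
proof -
  have sw: "continuous_map (fibre_product E p) (fibre_product E p) prod.swap"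
    unfolding fibre_product_def
    by (rule continuous_map_into_subtopology)
       (auto simp: continuous_map_pairwise o_def prod.swap_def
             intro: continuous_map_from_subtopology continuous_map_fst continuous_map_snd)
  have c: "k = 0 \<or> k = 1" if "k \<in> carrier Z2" for k
    using that by (auto simp: carrier_integer_mod_group)
  show ?thesis
    unfolding G_space_def
  proof (intro conjI ballI)
    fix k l z
    assume kl: "k \<in> carrier Z2" "l \<in> carrier Z2" and z: "z \<in> topspace (fibre_product E p)"
    show "swap_action (k \<otimes>\<^bsub>Z2\<^esub> l) z = swap_action k (swap_action l z)"
      using c [OF kl(1)] c [OF kl(2)] by (elim disjE) (simp_all add: swap_action_def)
  qed (use sw in \<open>simp_all add: swap_action_def\<close>)
qed

lemma G_space_fibrewise_path_space: "G_space Z2 (fibrewise_path_space E p) reversal_action"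
proof -
  let ?r = "\<lambda>\<gamma> :: real \<Rightarrow> 'a. restrict (\<lambda>t. \<gamma> (1 - t)) {0..1}"
  have flip: "continuous_map unit_interval unit_interval (\<lambda>t. 1 - t)"
    by (auto simp: continuous_map_subtopology_eu intro!: continuous_intros)
  have mem: "?r \<gamma> \<in> mapping_space unit_interval E" if "\<gamma> \<in> mapping_space unit_interval E" for \<gamma>
  proof -
    have "continuous_map unit_interval E (\<gamma> \<circ> (\<lambda>t. 1 - t))"
      using that by (intro continuous_map_compose [OF flip]) (simp add: mapping_space_def)
    then have "continuous_map unit_interval E (?r \<gamma>)"
      by (rule continuous_map_eq) auto
    then show ?thesis by (simp add: mapping_space_def)
  qed
  have "continuous_map (compact_open_topology unit_interval E) (compact_open_topology unit_interval E) ?r"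
  proof (rule continuous_map_into_compact_open_topology)
    fix K U assume K: "compactin unit_interval K" and U: "openin E U"
    have K': "compactin unit_interval ((\<lambda>t. 1 - t) ` K)"
      by (rule image_compactin [OF K flip])
    have "K \<subseteq> {0..1}" using compactin_subset_topspace [OF K] by simp
    then have "{\<gamma> \<in> topspace (compact_open_topology unit_interval E). ?r \<gamma> ` K \<subseteq> U}
        = {\<gamma> \<in> mapping_space unit_interval E. \<gamma> ` ((\<lambda>t. 1 - t) ` K) \<subseteq> U}"
      by (simp add: image_image subset_iff cong: conj_cong image_cong)
    then show "openin (compact_open_topology unit_interval E)
        {\<gamma> \<in> topspace (compact_open_topology unit_interval E). ?r \<gamma> ` K \<subseteq> U}"
      using openin_compact_open_topology [OF K' U] by simp
  qed (use mem in simp)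
  then have r: "continuous_map (fibrewise_path_space E p) (fibrewise_path_space E p) ?r"
    unfolding fibrewise_path_space_def
    by (intro continuous_map_into_subtopology continuous_map_from_subtopology) auto
  have rr: "?r (?r \<gamma>) = \<gamma>" if "\<gamma> \<in> topspace (fibrewise_path_space E p)" for \<gamma>
    using that by (intro ext) (simp add: fibrewise_path_space_def mapping_space_def extensional_def)
  have c: "k = 0 \<or> k = 1" if "k \<in> carrier Z2" for k
    using that by (auto simp: carrier_integer_mod_group)
  show ?thesis
    unfolding G_space_def
  proof (intro conjI ballI)
    fix k l \<gamma>
    assume kl: "k \<in> carrier Z2" "l \<in> carrier Z2" and g: "\<gamma> \<in> topspace (fibrewise_path_space E p)"
    show "reversal_action (k \<otimes>\<^bsub>Z2\<^esub> l) \<gamma> = reversal_action k (reversal_action l \<gamma>)"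
      using c [OF kl(1)] c [OF kl(2)] rr [OF g] by (elim disjE) (simp_all add: reversal_action_def)
  qed (use r in \<open>simp_all add: reversal_action_def\<close>)
qed

lemma G_map_endpoint_map:
  "G_map Z2 (fibrewise_path_space E p) reversal_action (fibre_product E p) swap_action endpoint_map"
proof -
  have ev: "continuous_map (compact_open_topology unit_interval E) E (\<lambda>\<gamma>. \<gamma> t)"
    if "t \<in> {0..1}" for t
  proof -
    have "continuous_map (compact_open_topology unit_interval E) E ((\<lambda>(t, f). f t) \<circ> (\<lambda>\<gamma>. (t, \<gamma>)))"
      by (rule continuous_map_compose [OF _ continuous_map_path_eval])
         (use that in \<open>simp add: continuous_map_pairwise o_def\<close>)
    then show ?thesis by (simp add: o_def)
  qed
  have "continuous_map (fibrewise_path_space E p) (fibre_product E p) endpoint_map"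
    unfolding fibrewise_path_space_def fibre_product_def
    by (intro continuous_map_into_subtopology continuous_map_from_subtopology)
       (auto simp: continuous_map_pairwise o_def endpoint_map_def ev)
  then show ?thesis
    by (auto simp: G_map_def equivariant_on_def endpoint_map_def reversal_action_def swap_action_def)
qed

end

theory Submission
  imports Defs
begin

text \<open>Since \<^const>\<open>equivariant_secat\<close> asks for sections only up to \<open>G\<close>-homotopy, a local section
  \<open>s\<close> of \<open>q : X \<rightarrow> Y\<close> over \<open>U\<close> can be transported along equivariant maps \<open>F : Y' \<rightarrow> Y\<close>,
  \<open>\<Psi> : Y \<rightarrow> Y'\<close> with \<open>\<Psi> \<circ> F\<close> \<open>G\<close>-homotopic to the identity and a map \<open>\<Phi> : X \<rightarrow> X'\<close>
  covering \<open>\<Psi>\<close>: over \<open>F\<^sup>-\<^sup>1 U\<close>, the map \<open>\<Phi> \<circ> s \<circ> F\<close> satisfies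
  \<open>q' \<circ> \<Phi> \<circ> s \<circ> F = \<Psi> \<circ> q \<circ> s \<circ> F \<simeq> \<Psi> \<circ> F \<simeq> id\<close>. A fibrewise homotopy equivalence \<open>(f, g)\<close>
  supplies \<open>F = f \<times> f\<close>, \<open>\<Psi> = g \<times> g\<close> and \<open>\<Phi> \<gamma> = g \<circ> \<gamma>\<close>.\<close>

lemma G_homotopic_compose_left:
  assumes hom: "G_homotopic G X actX Y actY f f'" and h: "G_map G Y actY Z actZ h"
  shows "G_homotopic G X actX Z actZ (h \<circ> f) (h \<circ> f')"
  unfolding G_homotopic_def
proof (rule homotopic_with_compose_continuous_map_left)
  \<comment> \<open>Equivariance of \<open>h\<close> is available only on \<open>topspace Y\<close>,
    so the property carried along the homotopy must also record that each stage lands there.\<close>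
  show "homotopic_with (\<lambda>j. equivariant_on G (topspace X) actX actY j \<and> j ` topspace X \<subseteq> topspace Y)
          X Y f f'"
    using hom unfolding G_homotopic_def
    by (rule homotopic_with_mono) (simp add: continuous_map_image_subset_topspace)
  show "continuous_map Y Z h"
    using h by (simp add: G_map_def)
  fix j assume "equivariant_on G (topspace X) actX actY j \<and> j ` topspace X \<subseteq> topspace Y"
  then show "equivariant_on G (topspace X) actX actZ (h \<circ> j)"
    using h by (auto simp: G_map_def equivariant_on_def)
qed

lemma G_homotopic_compose_right:
  assumes hom: "G_homotopic G Y actY Z actZ f f'" and h: "G_map G X actX Y actY h"
  shows "G_homotopic G X actX Z actZ (f \<circ> h) (f' \<circ> h)"
  using hom unfolding G_homotopic_def
proof (rule homotopic_with_compose_continuous_map_right)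
  show "continuous_map X Y h"
    using h by (simp add: G_map_def)
  fix j assume "equivariant_on G (topspace Y) actY actZ j"
  then show "equivariant_on G (topspace X) actX actZ (j \<circ> h)"
    using h continuous_map_image_subset_topspace [of X Y h]
    by (auto simp: G_map_def equivariant_on_def image_subset_iff)
qed

lemma G_map_compose:
  assumes f: "G_map G X actX Y actY f" and h: "G_map G Y actY Z actZ h"
  shows "G_map G X actX Z actZ (h \<circ> f)"
  using assms continuous_map_compose [of X Y f Z h] continuous_map_image_subset_topspace [of X Y f]
  by (auto simp: G_map_def equivariant_on_def image_subset_iff)

text \<open>Up to \<open>G\<close>-homotopy, \<open>F\<close> and \<open>\<Psi>\<close> exhibit
  \<open>Y'\<close> as dominated by \<open>Y\<close>. Pulling the cover back along \<open>F\<close>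
  keeps the number of sets, so \<open>k\<close> is unchanged.\<close>

lemma equivariant_sectional_cover_transfer:
  assumes Y': "G_space G Y' actY'"
    and F: "G_map G Y' actY' Y actY F"
    and \<Psi>: "G_map G Y actY Y' actY' \<Psi>"
    and \<Phi>: "G_map G X actX X' actX' \<Phi>"
    and square: "\<And>x. x \<in> topspace X \<Longrightarrow> q' (\<Phi> x) = \<Psi> (q x)"
    and hom: "G_homotopic G Y' actY' Y' actY' (\<Psi> \<circ> F) id"
    and cover: "equivariant_sectional_cover G X actX Y actY q k"
  shows "equivariant_sectional_cover G X' actX' Y' actY' q' k"
proof -
  from cover obtain U where UY: "(\<Union>i\<le>k. U i) = topspace Y"
    and U: "\<forall>i\<le>k. openin Y (U i) \<and> G_invariant G actY (U i) \<and>
           (\<exists>s. G_map G (subtopology Y (U i)) actY X actX s \<and>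
                G_homotopic G (subtopology Y (U i)) actY Y actY (q \<circ> s) id)"
    unfolding equivariant_sectional_cover_def by (elim exE conjE)
  have contF: "continuous_map Y' Y F"
    and eqF: "\<And>g y. g \<in> carrier G \<Longrightarrow> y \<in> topspace Y' \<Longrightarrow> F (actY' g y) = actY g (F y)"
    using F by (auto simp: G_map_def equivariant_on_def)
  have FY: "F y \<in> topspace Y" if "y \<in> topspace Y'" for y
    using continuous_map_image_subset_topspace [OF contF] that by blast
  \<comment> \<open>Orbits stay inside \<open>topspace Y'\<close>; together with equivariance of
    \<open>F\<close> this makes the preimages \<open>V i\<close> invariant.\<close>
  have act: "actY' g y \<in> topspace Y'" if "g \<in> carrier G" "y \<in> topspace Y'" for g y
    using Y' that continuous_map_image_subset_topspace [of Y' Y' "actY' g"]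
    unfolding G_space_def by blast
  define V where "V = (\<lambda>i. {y \<in> topspace Y'. F y \<in> U i})"
  show ?thesis
    unfolding equivariant_sectional_cover_def
  proof (intro exI [of _ V] conjI allI impI)
    show "(\<Union>i\<le>k. V i) = topspace Y'"
      using UY FY by (fastforce simp: V_def)
  next
    fix i assume i: "i \<le> k"
    have "openin Y (U i)" and inv: "G_invariant G actY (U i)"
      using U i by simp_all
    then show "openin Y' (V i)"
      unfolding V_def by (intro openin_continuous_map_preimage [OF contF])
    show "G_invariant G actY' (V i)"
      using inv act by (auto simp: G_invariant_def V_def eqF image_subset_iff)
    let ?U = "subtopology Y (U i)" and ?V = "subtopology Y' (V i)"
    obtain s where s: "G_map G ?U actY X actX s"
      and qs: "G_homotopic G ?U actY Y actY (q \<circ> s) id"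
      using U i by auto
    have FV: "G_map G ?V actY' ?U actY F"
      unfolding G_map_def
    proof
      show "continuous_map ?V ?U F"
        by (rule continuous_map_into_subtopology [OF continuous_map_from_subtopology [OF contF]])
           (auto simp: V_def)
      show "equivariant_on G (topspace ?V) actY' actY F"
        by (simp add: equivariant_on_def eqF)
    qed
    show "\<exists>s'. G_map G ?V actY' X' actX' s' \<and> G_homotopic G ?V actY' Y' actY' (q' \<circ> s') id"
    proof (intro exI conjI)
      have sF: "G_map G ?V actY' X actX (s \<circ> F)"
        by (rule G_map_compose [OF FV s])
      then show "G_map G ?V actY' X' actX' (\<Phi> \<circ> (s \<circ> F))"
        by (rule G_map_compose [OF _ \<Phi>])
      have sFX: "s (F y) \<in> topspace X" if "y \<in> topspace ?V" for y
        using sF that continuous_map_image_subset_topspace [of ?V X "s \<circ> F"]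
        by (auto simp: G_map_def image_subset_iff)
      have 1: "G_homotopic G ?V actY' Y' actY' (\<Psi> \<circ> ((q \<circ> s) \<circ> F)) (\<Psi> \<circ> (id \<circ> F))"
        by (rule G_homotopic_compose_left [OF G_homotopic_compose_right [OF qs FV] \<Psi>])
      \<comment> \<open>The inner \<open>id\<close> is the inclusion of \<open>?V\<close> into
        \<open>Y'\<close>; precomposing with it restricts the homotopy \<open>hom\<close> to
        \<open>?V\<close>.\<close>
      have 2: "G_homotopic G ?V actY' Y' actY' ((\<Psi> \<circ> F) \<circ> id) (id \<circ> id)"
        by (rule G_homotopic_compose_right [OF hom]) (simp add: G_map_def equivariant_on_def)
      have 3: "G_homotopic G ?V actY' Y' actY' (\<Psi> \<circ> ((q \<circ> s) \<circ> F)) id"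
        using homotopic_with_trans [OF 1 [unfolded G_homotopic_def]] 2
        by (simp add: G_homotopic_def)
      \<comment> \<open>The maps \<open>q' \<circ> \<Phi> \<circ> s \<circ> F\<close> and
        \<open>\<Psi> \<circ> q \<circ> s \<circ> F\<close> are only known to agree on
        \<open>?V\<close>. For equivariance to depend on values there alone, \<open>?V\<close> must
        be closed under the action.\<close>
      have closed: "actY' g y \<in> topspace ?V" if "g \<in> carrier G" "y \<in> topspace ?V" for g y
        using that \<open>G_invariant G actY' (V i)\<close> by (auto simp: G_invariant_def act image_subset_iff)
      show "G_homotopic G ?V actY' Y' actY' (q' \<circ> (\<Phi> \<circ> (s \<circ> F))) id"
        unfolding G_homotopic_def
        by (rule homotopic_with_eq [OF 3 [unfolded G_homotopic_def]])
           (use square sFX closed in \<open>auto simp: equivariant_on_def\<close>)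
    qed
  qed
qed

lemma G_map_fibre_product:
  assumes "fibrewise_map E p E' p' h"
  shows "G_map Z2 (fibre_product E p) swap_action (fibre_product E' p') swap_action (map_prod h h)"
  unfolding G_map_def
proof
  have h: "continuous_map E E' h" and ph: "\<And>e. e \<in> topspace E \<Longrightarrow> p' (h e) = p e"
    using assms by (auto simp: fibrewise_map_def)
  have "continuous_map (prod_topology E E) (prod_topology E' E') (map_prod h h)"
    using continuous_map_compose [OF continuous_map_fst h, of E]
      continuous_map_compose [OF continuous_map_snd h, of E]
    by (simp add: map_prod_def case_prod_unfold continuous_map_paired o_def)
  then show "continuous_map (fibre_product E p) (fibre_product E' p') (map_prod h h)"
    unfolding fibre_product_def
    by (intro continuous_map_into_subtopology continuous_map_from_subtopology) (auto simp: ph)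
  show "equivariant_on Z2 (topspace (fibre_product E p)) swap_action swap_action (map_prod h h)"
    by (auto simp: equivariant_on_def swap_action_def)
qed

text \<open>One fibrewise homotopy runs in both coordinates at the same time \<open>t\<close>: the
  two components stay over a common base point, and each stage commutes with the swap.\<close>

lemma G_homotopic_fibre_product:
  assumes "fibrewise_homotopic E p E' p' f f'"
  shows "G_homotopic Z2 (fibre_product E p) swap_action (fibre_product E' p') swap_action
           (map_prod f f) (map_prod f' f')"
proof -
  let ?I = "unit_interval"
  obtain K where K: "continuous_map (prod_topology ?I E) E' K"
    and K0: "\<And>x. K (0, x) = f x" and K1: "\<And>x. K (1, x) = f' x"
    and pK: "\<And>t e. t \<in> {0..1} \<Longrightarrow> e \<in> topspace E \<Longrightarrow> p' (K (t, e)) = p e"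
    using assms unfolding fibrewise_homotopic_def homotopic_with_def by blast
  let ?L = "\<lambda>z. (K (fst z, fst (snd z)), K (fst z, snd (snd z)))"
  \<comment> \<open>Both components of \<open>?L\<close> have this form, with \<open>c\<close> a
    projection.\<close>
  have "continuous_map (prod_topology ?I (prod_topology E E)) E' (\<lambda>z. K (fst z, c (snd z)))"
    if "continuous_map (prod_topology E E) E c" for c
  proof -
    have "continuous_map (prod_topology ?I (prod_topology E E)) (prod_topology ?I E)
            (\<lambda>z. (fst z, c (snd z)))"
      using continuous_map_compose [OF continuous_map_snd that, of ?I]
      by (simp add: continuous_map_pairwise o_def continuous_map_fst)
    then show ?thesis
      using continuous_map_compose [OF _ K] by (fastforce simp: o_def)
  qed
  then have "continuous_map (prod_topology ?I (prod_topology E E)) (prod_topology E' E') ?L"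
    by (simp add: continuous_map_paired continuous_map_fst continuous_map_snd)
  then have "continuous_map (prod_topology ?I (fibre_product E p)) (fibre_product E' p') ?L"
    unfolding fibre_product_def prod_topology_subtopology(2)
    by (intro continuous_map_into_subtopology continuous_map_from_subtopology) (auto simp: pK)
  then show ?thesis
    unfolding G_homotopic_def homotopic_with_def
    by (intro exI [of _ ?L]) (auto simp: K0 K1 equivariant_on_def swap_action_def)
qed

text \<open>This supplies \<open>\<Phi>\<close>. The restriction to \<open>{0..1}\<close> keeps the
  composite path extensional, as points of the mapping space must be.\<close>

lemma G_map_fibrewise_path_space:
  assumes "fibrewise_map E p E' p' h"
  shows "G_map Z2 (fibrewise_path_space E p) reversal_action (fibrewise_path_space E' p')
           reversal_action (\<lambda>\<gamma>. restrict (h \<circ> \<gamma>) {0..1})"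
  unfolding G_map_def
proof
  let ?h = "\<lambda>\<gamma>. restrict (h \<circ> \<gamma>) {0..1::real}"
  have h: "continuous_map E E' h" and ph: "\<And>e. e \<in> topspace E \<Longrightarrow> p' (h e) = p e"
    using assms by (auto simp: fibrewise_map_def)
  let ?P = "compact_open_topology unit_interval E"
  have in_E: "\<gamma> t \<in> topspace E" if "\<gamma> \<in> topspace ?P" "t \<in> {0..1}" for \<gamma> t
    using that by (auto simp: mapping_space_def continuous_map_def)
  \<comment> \<open>Postcomposition with \<open>h\<close> is the curried form of \<open>h\<close>
    after path evaluation, which is jointly continuous.\<close>
  have "continuous_map ?P (compact_open_topology unit_interval E')
     (\<lambda>\<gamma>. restrict (\<lambda>t. (h \<circ> (\<lambda>(t, \<gamma>). \<gamma> t)) (t, \<gamma>)) (topspace unit_interval))"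
    by (rule continuous_map_curry [OF continuous_map_compose [OF continuous_map_path_eval h]])
  then have "continuous_map ?P (compact_open_topology unit_interval E') ?h"
    by (simp add: o_def)
  then show "continuous_map (fibrewise_path_space E p) (fibrewise_path_space E' p') ?h"
    unfolding fibrewise_path_space_def
    by (intro continuous_map_into_subtopology continuous_map_from_subtopology)
       (auto simp: ph in_E [simplified])
  show "equivariant_on Z2 (topspace (fibrewise_path_space E p)) reversal_action reversal_action ?h"
    by (auto simp: equivariant_on_def reversal_action_def fun_eq_iff)
qed

lemma fibrewise_homotopy_equivalent_sym:
  "fibrewise_homotopy_equivalent E p E' p' \<Longrightarrow> fibrewise_homotopy_equivalent E' p' E p"
  unfolding fibrewise_homotopy_equivalent_def by blast

text \<open>The half \<open>g \<circ> f \<simeq> id\<close> of the equivalence gives one inequality;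
  symmetry of the relation then gives the other.\<close>

lemma TC_Sigma_le:
  assumes "fibrewise_homotopy_equivalent E p E' p'"
  shows "TC_Sigma E' p' \<le> TC_Sigma E p"
proof -
  obtain f g where f: "fibrewise_map E' p' E p f" and g: "fibrewise_map E p E' p' g"
    and gf: "fibrewise_homotopic E' p' E' p' (g \<circ> f) id"
    using assms unfolding fibrewise_homotopy_equivalent_def by blast
  have gf2: "G_homotopic Z2 (fibre_product E' p') swap_action (fibre_product E' p') swap_action
          (map_prod g g \<circ> map_prod f f) id"
    using G_homotopic_fibre_product [OF gf] by (simp add: map_prod.comp prod.map_id0)
  have "equivariant_sectional_cover Z2 (fibrewise_path_space E' p') reversal_action
          (fibre_product E' p') swap_action endpoint_map k"
    if "equivariant_sectional_cover Z2 (fibrewise_path_space E p) reversal_action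
          (fibre_product E p) swap_action endpoint_map k" for k
    by (rule equivariant_sectional_cover_transfer [OF G_space_fibre_product G_map_fibre_product [OF f]
          G_map_fibre_product [OF g] G_map_fibrewise_path_space [OF g] _ gf2 that])
       (simp add: endpoint_map_def)
  \<comment> \<open>Every \<open>k\<close> admissible for \<open>E\<close> is admissible for
    \<open>E'\<close>, and \<open>Inf\<close> reverses inclusion; an empty set for \<open>E\<close>
    gives the bound \<open>\<infinity>\<close>.\<close>
  then show ?thesis
    unfolding TC_Sigma_def equivariant_secat_def by (intro Inf_superset_mono image_mono) blast
qed

theorem proposition4p4:
  fixes E :: "'e topology" and E' :: "'f topology" and B :: "'b topology"
    and p :: "'e \<Rightarrow> 'b" and p' :: "'f \<Rightarrow> 'b"
  assumes "hurewicz_fibration E B p"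
    and "hurewicz_fibration E' B p'"
    and "fibrewise_homotopy_equivalent E p E' p'"
  shows "TC_Sigma E p = TC_Sigma E' p'"
  using TC_Sigma_le [OF assms(3)] TC_Sigma_le [OF fibrewise_homotopy_equivalent_sym [OF assms(3)]]
  by (rule antisym [rotated])

end
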